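(* The following equalities hold: \[\psi(Cut_{n+1})=OCut_n\quad\mbox{and}\quad OCut_n^*=OCut_n.\]
   Context: Let $V$ be a finite set with $|V|=n$ and let $0\notin V$. Let $E$ be the set of unordered pairs $(ij)$ of distinct elements of $V$, $E_0=\{(0i):i\in V\}$, and $E^{\cal O}$ the set of ordered pairs $ij$ of distinct elements of $V$. The Euclidean spaces ${\mathbb R}^{E\cup E_0}$ and ${\mathbb R}^{E^{\cal O}}$ have orthonormal bases $\{e_{(ij)}\}\cup\{e_{(0i)}\}$ and $\{e_{ij}\}$, respectively. For $S\subset V\cup\{0\}$ the cut vector $\delta(S)\in{\mathbb R}^{E\cup E_0}$ has coordinate $1$ at $(ij)$ if $|\{i,j\}\cap S|=1$ and $0$ otherwise. The cut cone $Cut_{n+1}$ is the conic hull of all cut vectors $\delta(S)$, $S\subset V\cup\{0\}$ (since $\delta(S)=\delta((V\cup\{0\})\setminus S)$, one may take only $S\subset V$). For $S\subset V$ the ocut vector is $c(S)=\sum_{i\in S,\,j\in V\setminus S}e_{ij}\in{\mathbb R}^{E^{\cal O}}$, and $OCut_n$ is the conic hull of all ocut vectors $c(S)$, $S\subset V$. For $k\in V$ let $q(k)=\sum_{j\in V\setminus\{k\}}(e_{kj}-e_{jk})$. The map $\psi:{\mathbb R}^{E\cup E_0}\to{\mathbb R}^{E^{\cal O}}$ is the linear map with $\psi(e_{(ij)})=e_{ij}+e_{ji}$ for $(ij)\in E$ and $\psi(e_{(0i)})=q(i)$ for $i\in V$. For $q\in{\mathbb R}^{E^{\cal O}}$, $q^*$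 is defined by $q^*_{ij}=q_{ji}$, and for a set $A$, $A^*=\{q^*:q\in A\}$. *)

theory Defs
  imports "HOL-Analysis.Analysis" "HOL-Analysis.Finite_Function_Topology"
begin

(* For a finite index set I, the space R^I is represented inside the real vector space of
   finitely supported functions: as the subspace of those supported in I.
   The basis vector at x is Poly_Mapping.single x 1, and the coordinate at x is
   Poly_Mapping.lookup v x. *)

definition coord_space :: "'i set \<Rightarrow> ('i \<Rightarrow>\<^sub>0 real) set" where
  "coord_space I = {v. Poly_Mapping.keys v \<subseteq> I}"

definition unit_vec :: "'i \<Rightarrow> ('i \<Rightarrow>\<^sub>0 real)" where
  "unit_vec x = Poly_Mapping.single x 1"

(* Applied to insert z V, with z playing the role of the extra point 0,
   this is the union of E and E_0. *)
definition edges :: "'a set \<Rightarrow> 'a set set" where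
  "edges W = {{i, j} | i j. i \<in> W \<and> j \<in> W \<and> i \<noteq> j}"

definition arcs :: "'a set \<Rightarrow> ('a \<times> 'a) set" where
  "arcs V = {(i, j). i \<in> V \<and> j \<in> V \<and> i \<noteq> j}"

definition cut_vector :: "'a set \<Rightarrow> 'a set \<Rightarrow> ('a set \<Rightarrow>\<^sub>0 real)" where
  "cut_vector W S = (\<Sum>e \<in> {e \<in> edges W. card (e \<inter> S) = 1}. unit_vec e)"

(* The conic hull in the sense of all nonnegative linear combinations is the library's
   convex_cone hull; the library's conic hull consists of nonnegative multiples only. *)
definition cut_cone :: "'a set \<Rightarrow> ('a set \<Rightarrow>\<^sub>0 real) set" where
  "cut_cone W = convex_cone hull {cut_vector W S | S. S \<subseteq> W}"

definition ocut_vector :: "'a set \<Rightarrow> 'a set \<Rightarrow> ('a \<times> 'a \<Rightarrow>\<^sub>0 real)" where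
  "ocut_vector V S = (\<Sum>i\<in>S. \<Sum>j\<in>V - S. unit_vec (i, j))"

definition ocut_cone :: "'a set \<Rightarrow> ('a \<times> 'a \<Rightarrow>\<^sub>0 real) set" where
  "ocut_cone V = convex_cone hull {ocut_vector V S | S. S \<subseteq> V}"

definition potential :: "'a set \<Rightarrow> 'a \<Rightarrow> ('a \<times> 'a \<Rightarrow>\<^sub>0 real)" where
  "potential V k = (\<Sum>j\<in>V - {k}. unit_vec (k, j) - unit_vec (j, k))"

(* The first sum runs over ordered pairs, so the coordinate at an edge {i, j} is multiplied
   with both basis vectors at (i, j) and (j, i); see psi_edge below.  Coordinates outside
   edges (insert z V) are ignored. *)
definition psi :: "'a set \<Rightarrow> 'a \<Rightarrow> ('a set \<Rightarrow>\<^sub>0 real) \<Rightarrow> ('a \<times> 'a \<Rightarrow>\<^sub>0 real)" where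
  "psi V z x =
     (\<Sum>(i, j)\<in>arcs V. Poly_Mapping.lookup x {i, j} *\<^sub>R unit_vec (i, j)) +
     (\<Sum>i\<in>V. Poly_Mapping.lookup x {z, i} *\<^sub>R potential V i)"

definition reversal :: "('a \<times> 'a \<Rightarrow>\<^sub>0 real) \<Rightarrow> ('a \<times> 'a \<Rightarrow>\<^sub>0 real)" where
  "reversal q = Poly_Mapping.map_key prod.swap q"

lemma lookup_unit_vec: "Poly_Mapping.lookup (unit_vec x) y = (if x = y then 1 else 0)"
  by (simp add: unit_vec_def lookup_single when_def)

lemma lookup_scaleR: "Poly_Mapping.lookup (c *\<^sub>R v) x = c *\<^sub>R Poly_Mapping.lookup v x"
proof -
  have "finite {i. c *\<^sub>R Poly_Mapping.lookup v i \<noteq> 0}"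
    by (rule finite_subset[OF _ finite_lookup[of v]]) auto
  then show ?thesis
    by (simp add: scaleR_poly_mapping_def Abs_poly_mapping_inverse)
qed

lemma lookup_reversal: "Poly_Mapping.lookup (reversal q) (i, j) = Poly_Mapping.lookup q (j, i)"
  by (simp add: reversal_def map_key.rep_eq)

lemma finite_edges: "finite W \<Longrightarrow> finite (edges W)"
  by (rule finite_subset[of _ "Pow W"]) (auto simp: edges_def)

lemma finite_arcs: "finite V \<Longrightarrow> finite (arcs V)"
  by (rule finite_subset[of _ "V \<times> V"]) (auto simp: arcs_def)

lemma lookup_cut_vector:
  assumes "finite W" "i \<in> W" "j \<in> W" "i \<noteq> j"
  shows "Poly_Mapping.lookup (cut_vector W S) {i, j} = (if card ({i, j} \<inter> S) = 1 then 1 else 0)"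
proof -
  have "finite {e \<in> edges W. card (e \<inter> S) = 1}"
    using finite_edges[OF assms(1)] by simp
  moreover have "{i, j} \<in> edges W"
    using assms by (auto simp: edges_def)
  ultimately show ?thesis
    by (simp add: cut_vector_def lookup_sum lookup_unit_vec)
qed

(* psi is the unique linear map on coord_space (edges (insert z V)) with the values
   given by psi_edge and psi_apex. *)

lemma linear_psi: "linear (psi V z)"
  by (rule linearI)
    (simp_all add: psi_def lookup_add lookup_scaleR scaleR_add_left sum.distrib case_prod_unfold scaleR_add_right
      scaleR_sum_right)

lemma psi_edge:
  assumes "finite V" "z \<notin> V" "i \<in> V" "j \<in> V" "i \<noteq> j"
  shows "psi V z (unit_vec {i, j}) = unit_vec (i, j) + unit_vec (j, i)"
proof -
  have "(\<Sum>i'\<in>V. Poly_Mapping.lookup (unit_vec {i, j}) {z, i'} *\<^sub>R potential V i') = 0"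
    using assms by (intro sum.neutral) (auto simp: lookup_unit_vec doubleton_eq_iff)
  moreover have "(\<Sum>(i', j')\<in>arcs V. Poly_Mapping.lookup (unit_vec {i, j}) {i', j'} *\<^sub>R unit_vec (i', j'))
    = (\<Sum>(i', j')\<in>{(i, j), (j, i)}. Poly_Mapping.lookup (unit_vec {i, j}) {i', j'} *\<^sub>R unit_vec (i', j'))"
    using assms finite_arcs[OF assms(1)]
    by (intro sum.mono_neutral_right) (auto simp: arcs_def lookup_unit_vec doubleton_eq_iff split: if_splits)
  ultimately show ?thesis
    using assms by (simp add: psi_def lookup_unit_vec insert_commute)
qed

lemma psi_apex:
  assumes "finite V" "z \<notin> V" "i \<in> V"
  shows "psi V z (unit_vec {z, i}) = potential V i"
proof -
  have "(\<Sum>(i', j')\<in>arcs V. Poly_Mapping.lookup (unit_vec {z, i}) {i', j'} *\<^sub>R unit_vec (i', j')) = 0"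
    using assms by (intro sum.neutral) (auto simp: arcs_def lookup_unit_vec doubleton_eq_iff)
  moreover have "(\<Sum>i'\<in>V. Poly_Mapping.lookup (unit_vec {z, i}) {z, i'} *\<^sub>R potential V i')
    = (\<Sum>i'\<in>{i}. Poly_Mapping.lookup (unit_vec {z, i}) {z, i'} *\<^sub>R potential V i')"
    using assms by (intro sum.mono_neutral_right) (auto simp: lookup_unit_vec doubleton_eq_iff)
  ultimately show ?thesis
    by (simp add: psi_def lookup_unit_vec)
qed

lemma subspace_coord_space: "subspace (coord_space I)"
  unfolding subspace_def coord_space_def subset_iff in_keys_iff mem_Collect_eq
  by (auto simp: lookup_add lookup_scaleR) (metis add.right_neutral)

lemma cut_cone_subset: "cut_cone W \<subseteq> coord_space (edges W)"
proof -
  have "cut_vector W S \<in> coord_space (edges W)" for S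
    unfolding cut_vector_def
    by (intro subspace_sum subspace_coord_space) (auto simp: coord_space_def unit_vec_def)
  then show ?thesis
    unfolding cut_cone_def
    by (intro hull_minimal) (auto intro: subspace_imp_convex_cone subspace_coord_space)
qed

lemma ocut_cone_subset: "ocut_cone V \<subseteq> coord_space (arcs V)"
proof -
  have "ocut_vector V S \<in> coord_space (arcs V)" if "S \<subseteq> V" for S
    unfolding ocut_vector_def using that
    by (intro subspace_sum subspace_coord_space) (auto simp: coord_space_def unit_vec_def arcs_def)
  then show ?thesis
    unfolding ocut_cone_def
    by (intro hull_minimal) (auto intro: subspace_imp_convex_cone subspace_coord_space)
qed

end

theory Submission
  imports Defs
begin

text \<open>
  Summing the potentials over \<open>S \<subseteq> V\<close> gives \<open>c(S) - c(S)\<^sup>*\<close>, since the terms with both indices in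
  \<open>S\<close> cancel, while the edges inside \<open>V\<close> cut by \<open>S\<close> contribute \<open>c(S) + c(S)\<^sup>*\<close>. Hence
  \<open>\<psi>(\<delta>(S)) = 2 c(S)\<close>. Because \<open>\<delta>\<close> is invariant under complements, sets containing the apex produce
  no further generators, and the first equality follows from linearity. The second one follows from
  \<open>c(S)\<^sup>* = c(V \<setminus> S)\<close>.
\<close>

text \<open>The potential of \<open>k\<close> is \<open>1\<close> on arcs leaving \<open>k\<close>,
  \<open>-1\<close> on arcs entering it and \<open>0\<close> elsewhere.\<close>

lemma lookup_potential:
  assumes "finite V" "k \<in> V"
  shows "Poly_Mapping.lookup (potential V k) (i, j) =
    (if (i, j) \<in> arcs V then of_bool (i = k) - of_bool (j = k) else 0)"
proof -
  have "Poly_Mapping.lookup (unit_vec (k, l) - unit_vec (l, k)) (i, j) =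
      (if l = j then of_bool (i = k) else 0) - (if l = i then of_bool (j = k) else 0)" for l
    by (auto simp: lookup_minus lookup_unit_vec)
  then have "Poly_Mapping.lookup (potential V k) (i, j) =
      (\<Sum>l\<in>V - {k}. if l = j then of_bool (i = k) else 0) -
      (\<Sum>l\<in>V - {k}. if l = i then of_bool (j = k) else 0)"
    unfolding potential_def lookup_sum by (simp only: sum_subtractf)
  also have "\<dots> = (if j \<in> V - {k} then of_bool (i = k) else 0) - (if i \<in> V - {k} then of_bool (j = k) else 0)"
    using assms by (simp only: sum.delta finite_Diff)
  \<comment> \<open>When one end is \<open>k\<close>, the other lying in \<open>V - {k}\<close> is
    exactly what makes \<open>(i, j)\<close> an arc, since \<open>k \<in> V\<close>.\<close>
  also have "\<dots> = (if (i, j) \<in> arcs V then of_bool (i = k) - of_bool (j = k) else 0)"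
    using assms(2) by (cases "i = k"; cases "j = k") (simp_all add: arcs_def)
  finally show ?thesis .
qed

text \<open>At an arc \<open>(i, j)\<close> only the potentials of \<open>i\<close> and
  \<open>j\<close> survive, with opposite signs. The resulting formula allows coordinatewise
  comparison.\<close>

lemma lookup_psi:
  assumes "finite V"
  shows "Poly_Mapping.lookup (psi V z x) (i, j) =
    (if (i, j) \<in> arcs V
     then Poly_Mapping.lookup x {i, j} + Poly_Mapping.lookup x {z, i} - Poly_Mapping.lookup x {z, j}
     else 0)"
proof -
  have "Poly_Mapping.lookup (psi V z x) (i, j) =
      (\<Sum>p\<in>arcs V. if p = (i, j) then Poly_Mapping.lookup x {i, j} else 0) +
      (\<Sum>k\<in>V. if (i, j) \<in> arcs V
         then (if k = i then Poly_Mapping.lookup x {z, i} else 0) -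
              (if k = j then Poly_Mapping.lookup x {z, j} else 0)
         else 0)"
    unfolding psi_def lookup_add lookup_sum
    using assms
    by (intro arg_cong2[where f = plus] sum.cong)
      (auto simp: lookup_scaleR lookup_unit_vec lookup_potential split: if_splits)
  also have "(\<Sum>p\<in>arcs V. if p = (i, j) then Poly_Mapping.lookup x {i, j} else 0) =
      (if (i, j) \<in> arcs V then Poly_Mapping.lookup x {i, j} else 0)"
    using finite_arcs[OF assms] by simp
  finally show ?thesis
    using assms by (auto simp: arcs_def sum_subtractf)
qed

lemma lookup_ocut_vector:
  assumes "finite V" "S \<subseteq> V"
  shows "Poly_Mapping.lookup (ocut_vector V S) (i, j) = of_bool (i \<in> S \<and> j \<in> V - S)"
proof -
  have "finite S"
    using assms finite_subset by blast
  have "Poly_Mapping.lookup (ocut_vector V S) (i, j) =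
      (\<Sum>k\<in>S. if k = i then (\<Sum>l\<in>V - S. if l = j then 1 else 0) else 0)"
    unfolding ocut_vector_def lookup_sum
    by (intro sum.cong) (auto simp: lookup_unit_vec intro: sum.cong)
  then show ?thesis
    using assms \<open>finite S\<close> by simp
qed

lemma card_doubleton_Int_eq_1_iff:
  assumes "i \<noteq> j"
  shows "card ({i, j} \<inter> S) = 1 \<longleftrightarrow> (i \<in> S \<longleftrightarrow> j \<notin> S)"
  using assms by (simp add: Int_insert_left)

text \<open>As \<open>z \<notin> S\<close>, the apex edges at \<open>i\<close> and \<open>j\<close>
  are cut iff \<open>i \<in> S\<close> and \<open>j \<in> S\<close> respectively. The coordinate at
  an arc is thus 1 + 1 - 0 if it leaves \<open>S\<close>, 1 + 0 - 1 if it enters \<open>S\<close>,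
  and 0 otherwise.\<close>

lemma psi_cut_vector:
  assumes "finite V" "z \<notin> V" "S \<subseteq> V"
  shows "psi V z (cut_vector (insert z V) S) = 2 *\<^sub>R ocut_vector V S"
proof (rule poly_mapping_eqI)
  fix p :: "'a \<times> 'a"
  obtain i j where [simp]: "p = (i, j)" by fastforce
  show "Poly_Mapping.lookup (psi V z (cut_vector (insert z V) S)) p =
      Poly_Mapping.lookup (2 *\<^sub>R ocut_vector V S) p"
  proof (cases "(i, j) \<in> arcs V")
    case True
    then have "i \<in> V" "j \<in> V" "i \<noteq> j" "z \<noteq> i" "z \<noteq> j"
      using assms by (auto simp: arcs_def)
    moreover have "z \<notin> S"
      using assms by blast
    ultimately show ?thesis
      using assms True
      by (simp add: lookup_psi lookup_cut_vector card_doubleton_Int_eq_1_iff[simplified]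
          lookup_scaleR lookup_ocut_vector)
  next
    \<comment> \<open>A pair with \<open>i \<in> S\<close> and \<open>j \<in> V - S\<close> would be
      an arc, so both sides vanish here.\<close>
    case False
    then show ?thesis
      using assms by (auto simp: lookup_psi lookup_scaleR lookup_ocut_vector arcs_def)
  qed
qed

text \<open>Both ends of an edge lie in \<open>W\<close>, so exactly one is in \<open>S\<close> iff
  exactly one is in \<open>W - S\<close>.\<close>

lemma cut_vector_complement:
  assumes "S \<subseteq> W"
  shows "cut_vector W (W - S) = cut_vector W S"
proof -
  have "card (e \<inter> (W - S)) = 1 \<longleftrightarrow> card (e \<inter> S) = 1" if "e \<in> edges W" for e
  proof -
    obtain i j where "e = {i, j}" "i \<in> W" "j \<in> W" "i \<noteq> j"
      using \<open>e \<in> edges W\<close> unfolding edges_def by blast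
    then show ?thesis
      using card_doubleton_Int_eq_1_iff[of i j] by auto
  qed
  then show ?thesis
    unfolding cut_vector_def by (intro sum.cong) auto
qed

text \<open>Each cut is represented by its side avoiding \<open>z\<close>, which brings every
  generator within reach of \<open>psi_cut_vector\<close>.\<close>

lemma cut_vectors_insert:
  assumes "z \<notin> V"
  shows "{cut_vector (insert z V) S | S. S \<subseteq> insert z V} = {cut_vector (insert z V) S | S. S \<subseteq> V}"
    (is "?L = ?R")
proof
  show "?L \<subseteq> ?R"
  proof
    fix v assume "v \<in> ?L"
    then obtain S where S: "S \<subseteq> insert z V" "v = cut_vector (insert z V) S"
      by blast
    show "v \<in> ?R"
    proof (cases "z \<in> S")
      case True
      then have "insert z V - S \<subseteq> V" by blast
      moreover have "v = cut_vector (insert z V) (insert z V - S)"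
        using S cut_vector_complement[OF S(1)] by simp
      ultimately show ?thesis by blast
    next
      case False
      then show ?thesis using S by blast
    qed
  qed
qed blast

text \<open>This absorbs the factor 2 from \<open>psi_cut_vector\<close>: cones are closed under
  scaling by \<open>c\<close> and by \<open>inverse c\<close>.\<close>

lemma convex_cone_hull_scaleR_image:
  fixes A :: "'b::real_vector set"
  assumes "c > 0"
  shows "convex_cone hull ((*\<^sub>R) c ` A) = convex_cone hull A"
proof
  show "convex_cone hull ((*\<^sub>R) c ` A) \<subseteq> convex_cone hull A"
    using assms
    by (intro hull_minimal) (auto simp: convex_cone_convex_cone_hull hull_inc intro!: convex_cone_hull_mul)
  have "a \<in> convex_cone hull ((*\<^sub>R) c ` A)" if "a \<in> A" for a
    using convex_cone_hull_mul[of "c *\<^sub>R a" "(*\<^sub>R) c ` A" "inverse c"] that assms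
    by (simp add: hull_inc)
  then show "convex_cone hull A \<subseteq> convex_cone hull ((*\<^sub>R) c ` A)"
    by (intro hull_minimal) (auto simp: convex_cone_convex_cone_hull)
qed

lemma linear_reversal: "linear reversal"
  by (rule linearI)
    (auto intro!: poly_mapping_eqI simp: lookup_reversal lookup_add lookup_scaleR)

text \<open>Reversed arcs run from \<open>V - S\<close> to \<open>S\<close>, and
  \<open>S = V - (V - S)\<close> because \<open>S \<subseteq> V\<close>.\<close>

lemma reversal_ocut_vector:
  assumes "finite V" "S \<subseteq> V"
  shows "reversal (ocut_vector V S) = ocut_vector V (V - S)"
  using assms
  by (intro poly_mapping_eqI) (auto simp: lookup_reversal lookup_ocut_vector)

theorem theorem5:
  fixes V :: "'a set" and z :: 'a
  assumes "finite V" and "z \<notin> V"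
  shows "psi V z ` cut_cone (insert z V) = ocut_cone V \<and>
         reversal ` ocut_cone V = ocut_cone V"
proof
  have "psi V z ` {cut_vector (insert z V) S | S. S \<subseteq> V} = (*\<^sub>R) 2 ` {ocut_vector V S | S. S \<subseteq> V}"
    unfolding setcompr_eq_image image_image
    by (intro image_cong) (auto simp: psi_cut_vector[OF assms])
  \<comment> \<open>A linear image of a convex cone hull is the hull of the image, so comparing
    generators suffices.\<close>
  then show "psi V z ` cut_cone (insert z V) = ocut_cone V"
    unfolding cut_cone_def ocut_cone_def cut_vectors_insert[OF assms(2)]
    unfolding convex_cone_hull_linear_image[OF linear_psi, symmetric]
    by (simp only: convex_cone_hull_scaleR_image zero_less_numeral)
  \<comment> \<open>Complementation is an involution on the subsets of \<open>V\<close>, so reversal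
    maps the generating set onto itself.\<close>
  have "(-) V ` {S. S \<subseteq> V} = {S. S \<subseteq> V}"
    by (auto simp: image_iff)
  then have "ocut_vector V ` (-) V ` {S. S \<subseteq> V} = ocut_vector V ` {S. S \<subseteq> V}"
    by (rule arg_cong)
  moreover have "reversal ` ocut_vector V ` {S. S \<subseteq> V} = ocut_vector V ` (-) V ` {S. S \<subseteq> V}"
    unfolding image_image
    by (intro image_cong) (auto simp: reversal_ocut_vector[OF assms(1)])
  ultimately have "reversal ` {ocut_vector V S | S. S \<subseteq> V} = {ocut_vector V S | S. S \<subseteq> V}"
    by (simp only: setcompr_eq_image)
  then show "reversal ` ocut_cone V = ocut_cone V"
    unfolding ocut_cone_def
    unfolding convex_cone_hull_linear_image[OF linear_reversal, symmetric]
    by (rule arg_cong)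
qed

end
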